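(* Let $N\ge 2$, let $p$ be a probability distribution on $\{0,1\}^N$, and let $A(i_1,\ldots,i_N)=\sqrt{p(i_1,\ldots,i_N)}$, $i_j\in\{0,1\}$, be its amplitude tensor. Let $1\le k\le N-1$ and suppose that $A$ factorizes across the consecutive cut after position $k$, i.e. there are real-valued tensors $A_L$ on $\{0,1\}^k$ and $A_R$ on $\{0,1\}^{N-k}$ such that $$A(i_1,\ldots,i_N)=A_L(i_1,\ldots,i_k)\,A_R(i_{k+1},\ldots,i_N)\qquad\text{for all }(i_1,\ldots,i_N)\in\{0,1\}^N.$$ Then the tensor-train rank $r_k$ of $A$ across the cut $(i_1,\ldots,i_k)\,|\,(i_{k+1},\ldots,i_N)$ equals $1$. Consequently, the nearest-neighbor edge $(k-1,k)$ associated with this cut does not belong to the TT-informed entangling set $E_{\mathrm{TT}}$ of $A$.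
   Context: A tensor-train (TT) decomposition of a tensor $A(i_1,\ldots,i_N)$ is a factorization $A(i_1,\ldots,i_N)=G^{(1)}(i_1)G^{(2)}(i_2)\cdots G^{(N)}(i_N)$, where $G^{(j)}(i_j)$ is a matrix of size $r_{j-1}\times r_j$ with $r_0=r_N=1$. The TT ranks $(r_1,\ldots,r_{N-1})$ of $A$ are the intermediate dimensions produced by the exact TT-SVD; the TT rank $r_k$ across the consecutive cut $(i_1,\ldots,i_k)\,|\,(i_{k+1},\ldots,i_N)$ equals the matrix rank of the unfolding of $A$, i.e. of the $2^k\times 2^{N-k}$ matrix whose rows are indexed by $(i_1,\ldots,i_k)$ and columns by $(i_{k+1},\ldots,i_N)$, with entries $A(i_1,\ldots,i_N)$. The qubits are labelled $0,1,\ldots,N-1$ (qubit $j-1$ corresponds to index $i_j$). The TT-informed entangling set is $$E_{\mathrm{TT}}=\{(k-1,k): r_k>1,\ k=1,\ldots,N-1\},$$ and the edge associated with the cut after position $k$ is $(k-1,k)$. *)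

theory Defs
  imports
    "HOL-Probability.Probability_Mass_Function"
    "Jordan_Normal_Form.DL_Rank"
begin

text \<open>
  A multi-index in \<open>{0,1}\<^sup>m\<close> is a list of \<open>m\<close> Booleans (\<open>False\<close> for 0, \<open>True\<close> for 1),
  so the entry written \<open>i\<^sub>j\<close> on paper is \<open>i ! (j - 1)\<close>. A tensor of order \<open>N\<close> is a function
  on such lists of which only the values on \<open>bitstrings N\<close> matter.
\<close>

definition bitstrings :: "nat \<Rightarrow> bool list set" where
  "bitstrings m = {i. length i = m}"

definition amplitude_tensor :: "bool list pmf \<Rightarrow> bool list \<Rightarrow> real" where
  "amplitude_tensor p i = sqrt (pmf p i)"

text \<open>
  Matrix rows and columns are numbered by naturals, so multi-indices have to be enumerated:
  \<open>List.n_lists m [False, True]\<close> lists every element of \<open>bitstrings m\<close> exactly once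
  (the first index varying fastest).
\<close>

definition unfolding_mat :: "nat \<Rightarrow> (bool list \<Rightarrow> real) \<Rightarrow> nat \<Rightarrow> real mat" where
  "unfolding_mat N A k =
     Matrix.mat (2 ^ k) (2 ^ (N - k))
       (\<lambda>(a, b). A (List.n_lists k [False, True] ! a @ List.n_lists (N - k) [False, True] ! b))"

text \<open>The first argument of \<open>vec_space.rank\<close> is the number of rows.\<close>

definition tt_rank :: "nat \<Rightarrow> (bool list \<Rightarrow> real) \<Rightarrow> nat \<Rightarrow> nat" where
  "tt_rank N A k = vec_space.rank (2 ^ k) (unfolding_mat N A k)"

definition tt_entangling_set :: "nat \<Rightarrow> (bool list \<Rightarrow> real) \<Rightarrow> (nat \<times> nat) set" where
  "tt_entangling_set N A = {(k - 1, k) | k. 1 \<le> k \<and> k \<le> N - 1 \<and> tt_rank N A k > 1}"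

end

theory Submission
  imports Defs
begin

text \<open>A factorization across the cut says that the unfolding is an outer product of a column
  vector (values of \<open>A_L\<close>) and a row vector (values of \<open>A_R\<close>), so its rank
  is at most 1 by \<open>rank_le_1_product_entries\<close>. Rank 0 is excluded because
  \<open>p\<close> has nonempty support, which yields a nonzero amplitude;
  \<open>rank_ge_1_nonzero_entry\<close> turns it into the lower bound. With rank exactly 1, the
  strict inequality defining the entangling set fails.\<close>

lemma set_n_lists_bool: "set (List.n_lists m [False, True]) = bitstrings m"
  by (auto simp: set_n_lists bitstrings_def)

lemma length_n_lists_bool: "length (List.n_lists m [False, True]) = 2 ^ m"
  by (simp add: length_n_lists numeral_2_eq_2)

text \<open>The column through the nonzero entry lies outside the span of the empty set, so it forms
  an independent singleton, and the rank bounds the size of any independent set of columns.\<close>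

lemma (in vec_space) rank_ge_1_nonzero_entry:
  assumes A: "A \<in> carrier_mat n nc"
    and r: "r < n" and c: "c < nc" and nonzero: "A $$ (r, c) \<noteq> 0"
  shows "rank A \<ge> 1"
proof -
  have col_carrier: "col A c \<in> carrier_vec n"
    using A by auto
  have "col A c \<noteq> 0\<^sub>v n"
    using A r c nonzero by (metis carrier_matD index_col index_zero_vec(1))
  then have "col A c \<notin> span {}"
    by (simp add: span_empty)
  moreover have "lin_indpt {}"
    by (simp add: lin_dep_def)
  ultimately have "lin_indpt {col A c}"
    using lin_dep_iff_in_span[of "{}" "col A c"] col_carrier by simp
  moreover have "col A c \<in> set (cols A)"
    using A c by (auto simp: cols_def)
  ultimately show ?thesis
    using rank_ge_card_indpt[OF A, of "{col A c}"] by simp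
qed

theorem proposition1:
  fixes N k :: nat
    and p :: "bool list pmf"
    and A A_L A_R :: "bool list \<Rightarrow> real"
  assumes "N \<ge> 2"
    and "set_pmf p \<subseteq> bitstrings N"
    and "A = amplitude_tensor p"
    and "1 \<le> k" and "k \<le> N - 1"
    and "\<forall>i \<in> bitstrings N. A i = A_L (take k i) * A_R (drop k i)"
  shows "tt_rank N A k = 1 \<and> (k - 1, k) \<notin> tt_entangling_set N A"
proof -
  let ?M = "unfolding_mat N A k"
  let ?row = "\<lambda>a. List.n_lists k [False, True] ! a"
  let ?col = "\<lambda>b. List.n_lists (N - k) [False, True] ! b"
  have k: "k \<le> N"
    using assms(5) by simp
  have M: "?M \<in> carrier_mat (2 ^ k) (2 ^ (N - k))"
    by (simp add: unfolding_mat_def)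
  have "?M $$ (a, b) = A_L (?row a) * A_R (?col b)"
    if "a < dim_row ?M" "b < dim_col ?M" for a b
  proof -
    have ab: "a < 2 ^ k" "b < 2 ^ (N - k)"
      using that M by auto
    then have "?row a \<in> bitstrings k" "?col b \<in> bitstrings (N - k)"
      by (metis length_n_lists_bool nth_mem set_n_lists_bool)+
    \<comment> \<open>The row index has length exactly \<open>k\<close>, so \<open>take k\<close>
      and \<open>drop k\<close> recover the two halves of the concatenation;
      \<open>k \<le> N\<close> gives it length \<open>N\<close>.\<close>
    then show ?thesis
      using ab k assms(6) by (simp add: unfolding_mat_def bitstrings_def)
  qed
  then have "vec_space.rank (2 ^ k) ?M \<le> 1"
    by (rule vec_space.rank_le_1_product_entries[OF M])
  moreover have "vec_space.rank (2 ^ k) ?M \<ge> 1"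
  proof -
    \<comment> \<open>Normalization enters here: total mass 1 forces a point of positive
      probability, so the tensor is not zero.\<close>
    obtain i where i: "i \<in> set_pmf p"
      using set_pmf_not_empty by fast
    then have "length i = N"
      using assms(2) by (auto simp: bitstrings_def)
    then have "take k i \<in> bitstrings k" "drop k i \<in> bitstrings (N - k)"
      using k by (auto simp: bitstrings_def)
    \<comment> \<open>The enumerations are exhaustive, so both halves of \<open>i\<close> occur at
      some row and column number.\<close>
    then obtain a b where ab: "a < 2 ^ k" "?row a = take k i"
      "b < 2 ^ (N - k)" "?col b = drop k i"
      by (metis in_set_conv_nth length_n_lists_bool set_n_lists_bool)
    then have "?M $$ (a, b) \<noteq> 0"
      using i by (simp add: unfolding_mat_def assms(3) amplitude_tensor_def set_pmf_iff)
    then show ?thesis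
      by (rule vec_space.rank_ge_1_nonzero_entry[OF M ab(1,3)])
  qed
  ultimately have rank: "tt_rank N A k = 1"
    by (simp add: tt_rank_def)
  moreover have "(k - 1, k) \<notin> tt_entangling_set N A"
    \<comment> \<open>The second component of an edge determines its cut, so only the rank at
      \<open>k\<close> itself matters.\<close>
    using rank by (auto simp: tt_entangling_set_def)
  ultimately show ?thesis ..
qed

end
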